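(* Let $n\ge1$ be an integer, $p$ an odd integer, $\mu=\mu_{1/(2n)}$, and suppose that both $E(\Gamma)=\{e_\gamma:\gamma\in\Gamma\}$ and $E(p\Gamma)=\{e_{p\gamma}:\gamma\in\Gamma\}$ are orthonormal bases of $L^2(\mu)$. Let $U$ be the unitary operator on $L^2(\mu)$ determined by $Ue_\gamma=e_{p\gamma}$, and $S_0$ the isometry determined by $S_0e_\gamma=e_{2n\gamma}$, for $\gamma\in\Gamma$. If $n$ is even, then $S_0$ and $U$ commute on $L^2(\mu)$.
   Context: For $\lambda\in(0,1)$, $\mu_\lambda$ is the unique Borel probability measure on $\mathbb{R}$ satisfying $\mu_\lambda=\frac12\mu_\lambda\circ\tau_+^{-1}+\frac12\mu_\lambda\circ\tau_-^{-1}$, where $\tau_\pm(x)=\lambda(x\pm1)$. For $t\in\mathbb{R}$, $e_t(x)=e^{2\pi i t x}$ in $L^2(\mu)$. $\Gamma=\{\sum_{i=0}^m a_i(2n)^i: m\ge0,\ a_i\in\{0,\frac n2\}\}$. *)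

theory Defs
  imports "HOL-Probability.Probability"
begin

definition tau :: "real \<Rightarrow> real \<Rightarrow> real \<Rightarrow> real" where
  "tau l s x = l * (x + s)"

text \<open>\<open>is_bernoulli_convolution l \<mu>\<close> says that \<open>\<mu>\<close> is the measure \<open>\<mu>\<^sub>l\<close>: the invariance
  equation has exactly one solution among Borel probability measures when \<open>0 < l < 1\<close>.\<close>

definition is_bernoulli_convolution :: "real \<Rightarrow> real measure \<Rightarrow> bool" where
  "is_bernoulli_convolution l \<mu> \<longleftrightarrow>
     prob_space \<mu> \<and> sets \<mu> = sets borel \<and>
     (\<forall>A\<in>sets borel. measure \<mu> A =
        1/2 * measure \<mu> (tau l 1 -` A) + 1/2 * measure \<mu> (tau l (-1) -` A))"

text \<open>Elements of \<open>L\<^sup>2(M)\<close> are represented by square-integrable functions. Equality in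
  \<open>L\<^sup>2(M)\<close> is equality almost everywhere, and operators on \<open>L\<^sup>2(M)\<close> are maps on
  representatives that respect it; their values outside \<open>L2 M\<close> are irrelevant.\<close>

definition L2 :: "'a measure \<Rightarrow> ('a \<Rightarrow> complex) set" where
  "L2 M = {f \<in> borel_measurable M. integrable M (\<lambda>x. (cmod (f x))\<^sup>2)}"

definition L2_inner :: "'a measure \<Rightarrow> ('a \<Rightarrow> complex) \<Rightarrow> ('a \<Rightarrow> complex) \<Rightarrow> complex" where
  "L2_inner M f g = (LINT x|M. f x * cnj (g x))"

definition L2_norm :: "'a measure \<Rightarrow> ('a \<Rightarrow> complex) \<Rightarrow> real" where
  "L2_norm M f = sqrt (LINT x|M. (cmod (f x))\<^sup>2)"

definition L2_eq :: "'a measure \<Rightarrow> ('a \<Rightarrow> complex) \<Rightarrow> ('a \<Rightarrow> complex) \<Rightarrow> bool" where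
  "L2_eq M f g \<longleftrightarrow> (AE x in M. f x = g x)"

definition L2_orthonormal :: "'a measure \<Rightarrow> ('a \<Rightarrow> complex) set \<Rightarrow> bool" where
  "L2_orthonormal M B \<longleftrightarrow>
     B \<subseteq> L2 M \<and> (\<forall>f\<in>B. \<forall>g\<in>B. L2_inner M f g = (if f = g then 1 else 0))"

text \<open>An orthonormal basis is an orthonormal set with dense linear span.\<close>

definition L2_orthonormal_basis :: "'a measure \<Rightarrow> ('a \<Rightarrow> complex) set \<Rightarrow> bool" where
  "L2_orthonormal_basis M B \<longleftrightarrow>
     L2_orthonormal M B \<and>
     (\<forall>f\<in>L2 M. \<forall>\<epsilon>>0. \<exists>F c. finite F \<and> F \<subseteq> B \<and>
        L2_norm M (\<lambda>x. f x - (\<Sum>b\<in>F. c b * b x)) < \<epsilon>)"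

definition L2_linear_operator ::
  "'a measure \<Rightarrow> (('a \<Rightarrow> complex) \<Rightarrow> ('a \<Rightarrow> complex)) \<Rightarrow> bool" where
  "L2_linear_operator M T \<longleftrightarrow>
     (\<forall>f\<in>L2 M. T f \<in> L2 M) \<and>
     (\<forall>f\<in>L2 M. \<forall>g\<in>L2 M. L2_eq M f g \<longrightarrow> L2_eq M (T f) (T g)) \<and>
     (\<forall>f\<in>L2 M. \<forall>g\<in>L2 M. L2_eq M (T (\<lambda>x. f x + g x)) (\<lambda>x. T f x + T g x)) \<and>
     (\<forall>c. \<forall>f\<in>L2 M. L2_eq M (T (\<lambda>x. c * f x)) (\<lambda>x. c * T f x))"

definition L2_isometry ::
  "'a measure \<Rightarrow> (('a \<Rightarrow> complex) \<Rightarrow> ('a \<Rightarrow> complex)) \<Rightarrow> bool" where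
  "L2_isometry M T \<longleftrightarrow>
     L2_linear_operator M T \<and> (\<forall>f\<in>L2 M. L2_norm M (T f) = L2_norm M f)"

definition L2_unitary ::
  "'a measure \<Rightarrow> (('a \<Rightarrow> complex) \<Rightarrow> ('a \<Rightarrow> complex)) \<Rightarrow> bool" where
  "L2_unitary M T \<longleftrightarrow>
     L2_isometry M T \<and> (\<forall>g\<in>L2 M. \<exists>f\<in>L2 M. L2_eq M (T f) g)"

definition expo :: "real \<Rightarrow> real \<Rightarrow> complex" where
  "expo t x = exp (2 * of_real pi * \<i> * of_real t * of_real x)"

definition Gamma_set :: "nat \<Rightarrow> real set" where
  "Gamma_set n =
     {(\<Sum>i\<le>m. a i * (2 * real n) ^ i) | (m::nat) (a :: nat \<Rightarrow> real).
        \<forall>i\<le>m. a i \<in> {0, real n / 2}}"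

end

theory Submission
  imports Defs
begin

text \<open>For even \<open>n\<close> all elements of \<open>\<Gamma>\<close> are integers, so the exponentials in play are
  1-periodic. The invariance equation says that \<open>x \<mapsto> 2nx\<close> preserves the image of \<open>\<mu>\<close> in
  \<open>\<real>/\<int>\<close>, hence \<open>h \<mapsto> h(2n \<cdot>)\<close> is isometric on 1-periodic functions. By approximation in the
  span of \<open>E(\<Gamma>)\<close>, this forces \<open>S\<^sub>0 e\<^sub>k = e\<^bsub>2nk\<^esub>\<close> for every integer \<open>k\<close>, not only for \<open>k \<in> \<Gamma>\<close>.
  So \<open>S\<^sub>0 U\<close> and \<open>U S\<^sub>0\<close> both map \<open>e\<^sub>\<gamma>\<close> to \<open>e\<^bsub>2np\<gamma>\<^esub>\<close>.\<close>

section \<open>Square-integrable functions modulo almost everywhere equality\<close>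

lemma L2_eq_sym: "L2_eq M f g \<Longrightarrow> L2_eq M g f"
  unfolding L2_eq_def by (auto elim: eventually_mono)

lemma L2_eq_trans [trans]: "L2_eq M f g \<Longrightarrow> L2_eq M g h \<Longrightarrow> L2_eq M f h"
  unfolding L2_eq_def by (auto elim: eventually_elim2)

lemma L2_measurable [measurable_dest]: "f \<in> L2 M \<Longrightarrow> f \<in> borel_measurable M"
  by (simp add: L2_def)

lemma L2_integrable: "f \<in> L2 M \<Longrightarrow> integrable M (\<lambda>x. (cmod (f x))\<^sup>2)"
  by (simp add: L2_def)

text \<open>Follows from \<open>(cmod a - cmod b)\<^sup>2 \<ge> 0\<close>. It serves below in place
  of the triangle inequality for \<open>L2_norm\<close>.\<close>

lemma cmod_add_squared_le: "(cmod (a + b))\<^sup>2 \<le> 2 * (cmod a)\<^sup>2 + 2 * (cmod b)\<^sup>2"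
proof -
  have "(cmod (a + b))\<^sup>2 \<le> (cmod a + cmod b)\<^sup>2"
    by (simp add: norm_triangle_ineq power_mono)
  also have "\<dots> \<le> 2 * (cmod a)\<^sup>2 + 2 * (cmod b)\<^sup>2"
    using zero_le_power2[of "cmod a - cmod b"] by (simp add: power2_eq_square algebra_simps)
  finally show ?thesis .
qed

lemma L2_add:
  assumes "f \<in> L2 M" "g \<in> L2 M"
  shows "(\<lambda>x. f x + g x) \<in> L2 M"
proof -
  note [measurable] = assms[THEN L2_measurable]
  have "integrable M (\<lambda>x. (cmod (f x + g x))\<^sup>2)"
    by (rule Bochner_Integration.integrable_bound[where f = "\<lambda>x. 2 * (cmod (f x))\<^sup>2 + 2 * (cmod (g x))\<^sup>2"])
       (use assms in \<open>auto simp: L2_integrable cmod_add_squared_le\<close>)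
  then show ?thesis by (simp add: L2_def)
qed

lemma L2_scale: "f \<in> L2 M \<Longrightarrow> (\<lambda>x. c * f x) \<in> L2 M"
  by (auto simp: L2_def norm_mult power_mult_distrib)

lemma L2_diff: "f \<in> L2 M \<Longrightarrow> g \<in> L2 M \<Longrightarrow> (\<lambda>x. f x - g x) \<in> L2 M"
  using L2_add[OF _ L2_scale[of g M "-1"]] by simp

lemma L2_zero: "(\<lambda>x. 0) \<in> L2 M"
  by (simp add: L2_def)

lemma L2_sum: "(\<And>b. b \<in> F \<Longrightarrow> f b \<in> L2 M) \<Longrightarrow> (\<lambda>x. \<Sum>b\<in>F. c b * f b x) \<in> L2 M"
  by (induction F rule: infinite_finite_induct) (auto simp: L2_zero intro!: L2_add L2_scale)

lemma L2_norm_squared: "(L2_norm M f)\<^sup>2 = (LINT x|M. (cmod (f x))\<^sup>2)"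
  by (simp add: L2_norm_def)

lemma L2_norm_cong:
  assumes "L2_eq M f g" "f \<in> borel_measurable M" "g \<in> borel_measurable M"
  shows "L2_norm M f = L2_norm M g"
  using assms unfolding L2_norm_def L2_eq_def
  by (intro arg_cong[where f = sqrt] integral_cong_AE) (auto elim: eventually_mono)

lemma L2_eq_if_norm_diff_zero:
  assumes "f \<in> L2 M" "g \<in> L2 M" "L2_norm M (\<lambda>x. f x - g x) = 0"
  shows "L2_eq M f g"
proof -
  have "AE x in M. (cmod (f x - g x))\<^sup>2 = 0"
    using assms(3) L2_integrable[OF L2_diff[OF assms(1,2)]]
    by (subst (asm) L2_norm_def) (simp add: integral_nonneg_eq_0_iff_AE)
  then show ?thesis unfolding L2_eq_def by (auto elim: eventually_mono)
qed

text \<open>Both density arguments below end here: one function \<open>h\<close> close to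
  \<open>f\<close> and to \<open>g\<close> bounds the distance of \<open>f\<close> and
  \<open>g\<close>, so a positive distance contradicts itself.\<close>

lemma L2_eq_if_common_approx:
  assumes f: "f \<in> L2 M" and g: "g \<in> L2 M"
    and approx: "\<And>\<epsilon>. \<epsilon> > 0 \<Longrightarrow> \<exists>h\<in>L2 M. L2_norm M (\<lambda>x. f x - h x) < \<epsilon> \<and> L2_norm M (\<lambda>x. g x - h x) < \<epsilon>"
  shows "L2_eq M f g"
proof (rule L2_eq_if_norm_diff_zero[OF f g], rule ccontr)
  let ?d = "L2_norm M (\<lambda>x. f x - g x)"
  assume "?d \<noteq> 0"
  moreover have "?d \<ge> 0" by (simp add: L2_norm_def)
  \<comment> \<open>Half the distance is exactly what the constants of
    \<open>cmod_add_squared_le\<close> require: two terms \<open>2 * (?d / 2)\<^sup>2\<close> add up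
    to \<open>?d\<^sup>2\<close>.\<close>
  ultimately have "?d / 2 > 0" by simp
  from approx[OF this] obtain h where h: "h \<in> L2 M"
    and fh: "L2_norm M (\<lambda>x. f x - h x) < ?d / 2" and gh: "L2_norm M (\<lambda>x. g x - h x) < ?d / 2" by blast
  have bound: "(cmod (f x - g x))\<^sup>2 \<le> 2 * (cmod (f x - h x))\<^sup>2 + 2 * (cmod (g x - h x))\<^sup>2" for x
    using cmod_add_squared_le[of "f x - h x" "h x - g x"] by (simp add: norm_minus_commute)
  have sq: "(L2_norm M u)\<^sup>2 < (?d / 2)\<^sup>2" if "L2_norm M u < ?d / 2" for u
    using that by (intro power_strict_mono) (auto simp: L2_norm_def)
  have "?d\<^sup>2 \<le> (LINT x|M. 2 * (cmod (f x - h x))\<^sup>2 + 2 * (cmod (g x - h x))\<^sup>2)"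
    unfolding L2_norm_squared
    by (intro integral_mono bound Bochner_Integration.integrable_add integrable_mult_right
        L2_integrable L2_diff f g h)
  also have "\<dots> = 2 * (L2_norm M (\<lambda>x. f x - h x))\<^sup>2 + 2 * (L2_norm M (\<lambda>x. g x - h x))\<^sup>2"
    unfolding L2_norm_squared
    using L2_integrable[OF L2_diff[OF f h]] L2_integrable[OF L2_diff[OF g h]] by simp
  also have "\<dots> < 2 * (?d / 2)\<^sup>2 + 2 * (?d / 2)\<^sup>2"
    using sq[OF fh] sq[OF gh] by simp
  finally show False by (simp add: power2_eq_square)
qed

section \<open>Linear operators and isometries on representatives\<close>

context
  fixes M :: "'a measure" and T
  assumes T: "L2_linear_operator M T"
begin

lemma L2_linear_closed: "f \<in> L2 M \<Longrightarrow> T f \<in> L2 M"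
  and L2_linear_cong: "f \<in> L2 M \<Longrightarrow> g \<in> L2 M \<Longrightarrow> L2_eq M f g \<Longrightarrow> L2_eq M (T f) (T g)"
  and L2_linear_add: "f \<in> L2 M \<Longrightarrow> g \<in> L2 M \<Longrightarrow> L2_eq M (T (\<lambda>x. f x + g x)) (\<lambda>x. T f x + T g x)"
  and L2_linear_scale: "f \<in> L2 M \<Longrightarrow> L2_eq M (T (\<lambda>x. c * f x)) (\<lambda>x. c * T f x)"
  using T unfolding L2_linear_operator_def by blast+

lemma L2_linear_sum:
  assumes "finite F" "F \<subseteq> L2 M"
  shows "L2_eq M (T (\<lambda>x. \<Sum>b\<in>F. c b * b x)) (\<lambda>x. \<Sum>b\<in>F. c b * T b x)"
  using assms
proof (induction F)
  case empty
  show ?case using L2_linear_scale[OF L2_zero, of 0] by simp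
next
  case (insert b F)
  have "L2_eq M (T (\<lambda>x. c b * b x + (\<Sum>b\<in>F. c b * b x)))
      (\<lambda>x. T (\<lambda>x. c b * b x) x + T (\<lambda>x. \<Sum>b\<in>F. c b * b x) x)"
    using insert.prems by (intro L2_linear_add L2_scale L2_sum) auto
  moreover have "L2_eq M (T (\<lambda>x. c b * b x)) (\<lambda>x. c b * T b x)"
    using insert.prems by (intro L2_linear_scale) auto
  moreover have "L2_eq M (T (\<lambda>x. \<Sum>b\<in>F. c b * b x)) (\<lambda>x. \<Sum>b\<in>F. c b * T b x)"
    using insert by auto
  ultimately show ?case
    unfolding L2_eq_def using insert.hyps by (simp, elim AE_mp) (auto intro!: AE_I2)
qed

lemma L2_linear_diff_sum:
  assumes "f \<in> L2 M" "finite F" "F \<subseteq> L2 M"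
  shows "L2_eq M (T (\<lambda>x. f x - (\<Sum>b\<in>F. c b * b x))) (\<lambda>x. T f x - (\<Sum>b\<in>F. c b * T b x))"
proof -
  \<comment> \<open>Linearity is stated for sums and multiples, so the subtraction is moved into the
    coefficients.\<close>
  have "L2_eq M (T (\<lambda>x. f x + (\<Sum>b\<in>F. - c b * b x)))
      (\<lambda>x. T f x + T (\<lambda>x. \<Sum>b\<in>F. - c b * b x) x)"
    using assms by (intro L2_linear_add L2_sum) auto
  moreover have "L2_eq M (T (\<lambda>x. \<Sum>b\<in>F. - c b * b x)) (\<lambda>x. \<Sum>b\<in>F. - c b * T b x)"
    using L2_linear_sum[OF assms(2,3), of "\<lambda>b. - c b"] by simp
  ultimately show ?thesis
    unfolding L2_eq_def by (auto simp: sum_negf elim: eventually_elim2)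
qed

end

lemma L2_isometry_linear: "L2_isometry M T \<Longrightarrow> L2_linear_operator M T"
  by (simp add: L2_isometry_def)

text \<open>Norm preservation applied to the error function, after linearity has moved
  \<open>T\<close> inside. An approximation of \<open>f\<close> thus becomes one of
  \<open>T f\<close> with the same coefficients and the same error.\<close>

lemma L2_isometry_norm_diff_sum:
  assumes T: "L2_isometry M T" and f: "f \<in> L2 M" and F: "finite F" "F \<subseteq> L2 M"
  shows "L2_norm M (\<lambda>x. T f x - (\<Sum>b\<in>F. c b * T b x)) = L2_norm M (\<lambda>x. f x - (\<Sum>b\<in>F. c b * b x))"
proof -
  note lin = L2_isometry_linear[OF T]
  let ?g = "\<lambda>x. f x - (\<Sum>b\<in>F. c b * b x)"
  have g: "?g \<in> L2 M" using f F by (intro L2_diff L2_sum) auto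
  have "(\<lambda>x. T f x - (\<Sum>b\<in>F. c b * T b x)) \<in> L2 M"
    using f F by (intro L2_diff L2_sum L2_linear_closed[OF lin]) auto
  then have "L2_norm M (\<lambda>x. T f x - (\<Sum>b\<in>F. c b * T b x)) = L2_norm M (T ?g)"
    by (intro L2_norm_cong L2_eq_sym[OF L2_linear_diff_sum] L2_measurable L2_linear_closed[OF lin] g lin f F)
  then show ?thesis using T g by (simp add: L2_isometry_def)
qed

text \<open>\<open>T\<close> is additive and homogeneous only almost everywhere, so \<open>S\<close>
  has to respect \<open>L2_eq\<close> for these identities to pass through it.\<close>

lemma L2_isometry_comp:
  assumes S: "L2_isometry M S" and T: "L2_isometry M T"
  shows "L2_isometry M (\<lambda>f. S (T f))"
proof -
  note s = L2_isometry_linear[OF S] and t = L2_isometry_linear[OF T]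
  have "L2_eq M (S (T (\<lambda>x. f x + g x))) (\<lambda>x. S (T f) x + S (T g) x)"
    if "f \<in> L2 M" "g \<in> L2 M" for f g
    using L2_eq_trans[OF L2_linear_cong[OF s _ _ L2_linear_add[OF t that]] L2_linear_add[OF s]] that
    by (simp add: L2_add L2_linear_closed[OF t])
  moreover have "L2_eq M (S (T (\<lambda>x. c * f x))) (\<lambda>x. c * S (T f) x)" if "f \<in> L2 M" for f c
    using L2_eq_trans[OF L2_linear_cong[OF s _ _ L2_linear_scale[OF t that]] L2_linear_scale[OF s]] that
    by (simp add: L2_scale L2_linear_closed[OF t])
  ultimately show ?thesis
    using S T unfolding L2_isometry_def L2_linear_operator_def by (auto intro: L2_linear_cong[OF s])
qed

section \<open>Approximation by finite combinations of basis vectors\<close>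

lemma L2_basis_subset: "L2_orthonormal_basis M B \<Longrightarrow> B \<subseteq> L2 M"
  by (simp add: L2_orthonormal_basis_def L2_orthonormal_def)

lemma L2_basis_approx:
  assumes "L2_orthonormal_basis M B" "f \<in> L2 M" "\<epsilon> > 0"
  obtains F c where "finite F" "F \<subseteq> B" "L2_norm M (\<lambda>x. f x - (\<Sum>b\<in>F. c b * b x)) < \<epsilon>"
  using assms unfolding L2_orthonormal_basis_def by blast

text \<open>Each \<open>b\<close> has its own exceptional null set; as \<open>F\<close> is finite,
  their union is still null.\<close>

lemma L2_norm_diff_sum_cong:
  assumes "f \<in> L2 M" "finite F" "\<And>b. b \<in> F \<Longrightarrow> u b \<in> L2 M" "\<And>b. b \<in> F \<Longrightarrow> v b \<in> L2 M"
    and "\<And>b. b \<in> F \<Longrightarrow> L2_eq M (u b) (v b)"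
  shows "L2_norm M (\<lambda>x. f x - (\<Sum>b\<in>F. c b * u b x)) = L2_norm M (\<lambda>x. f x - (\<Sum>b\<in>F. c b * v b x))"
proof (rule L2_norm_cong)
  have "AE x in M. \<forall>b\<in>F. u b x = v b x"
    using assms(2,5) by (intro AE_finite_allI) (auto simp: L2_eq_def)
  then show "L2_eq M (\<lambda>x. f x - (\<Sum>b\<in>F. c b * u b x)) (\<lambda>x. f x - (\<Sum>b\<in>F. c b * v b x))"
    unfolding L2_eq_def by (auto elim!: eventually_mono)
qed (use assms in \<open>auto intro!: L2_measurable[OF L2_diff] L2_sum\<close>)

text \<open>If a combination of basis vectors approximates \<open>f\<close>, its image under
  \<open>S\<close> approximates \<open>S f\<close> and, by agreement on the basis, also
  \<open>T f\<close>.\<close>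

lemma L2_isometries_eq_on_basis:
  assumes B: "L2_orthonormal_basis M B" and S: "L2_isometry M S" and T: "L2_isometry M T"
    and eq: "\<And>b. b \<in> B \<Longrightarrow> L2_eq M (S b) (T b)" and f: "f \<in> L2 M"
  shows "L2_eq M (S f) (T f)"
proof (rule L2_eq_if_common_approx)
  note sT = L2_linear_closed[OF L2_isometry_linear[OF S]] L2_linear_closed[OF L2_isometry_linear[OF T]]
  show "S f \<in> L2 M" "T f \<in> L2 M" using f by (auto intro: sT)
  fix \<epsilon> :: real assume "\<epsilon> > 0"
  then obtain F c where F: "finite F" "F \<subseteq> B" and
    less: "L2_norm M (\<lambda>x. f x - (\<Sum>b\<in>F. c b * b x)) < \<epsilon>"
    using L2_basis_approx[OF B f] by blast
  have FL: "F \<subseteq> L2 M" using F L2_basis_subset[OF B] by auto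
  have "L2_norm M (\<lambda>x. T f x - (\<Sum>b\<in>F. c b * S b x)) = L2_norm M (\<lambda>x. T f x - (\<Sum>b\<in>F. c b * T b x))"
    using F FL f eq by (intro L2_norm_diff_sum_cong) (auto intro: sT)
  with less show "\<exists>h\<in>L2 M. L2_norm M (\<lambda>x. S f x - h x) < \<epsilon> \<and> L2_norm M (\<lambda>x. T f x - h x) < \<epsilon>"
    using F FL f
    by (intro bexI[of _ "\<lambda>x. \<Sum>b\<in>F. c b * S b x"])
       (auto simp: L2_isometry_norm_diff_sum[OF S] L2_isometry_norm_diff_sum[OF T] intro!: L2_sum sT)
qed

section \<open>Exponentials and their periodicity\<close>

lemma expo_in_L2:
  assumes "finite_measure M" "sets M = sets borel"
  shows "expo t \<in> L2 M"
proof -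
  have "expo t \<in> borel_measurable M"
    unfolding measurable_cong_sets[OF assms(2) refl] expo_def
    by (intro borel_measurable_continuous_onI continuous_intros)
  then show ?thesis
    using finite_measure.integrable_const[OF assms(1)]
    by (simp add: L2_def expo_def norm_exp_eq_Re)
qed

lemma expo_periodic: "t \<in> \<int> \<Longrightarrow> expo t (x + of_int k) = expo t x"
proof -
  assume "t \<in> \<int>"
  then obtain j where "t = of_int j" by (auto elim: Ints_cases)
  then have "expo t (x + of_int k) = exp (2 * pi * \<i> * t * x) * exp (2 * of_int (j * k) * pi * \<i>)"
    unfolding expo_def exp_add[symmetric] by (simp add: algebra_simps)
  then show ?thesis using exp_integer_2pi[of "of_int (j * k)"]
    by (simp only: expo_def) (simp add: mult_ac)
qed

lemma expo_frac: "t \<in> \<int> \<Longrightarrow> expo t (frac x) = expo t x"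
  using expo_periodic[of t x "- \<lfloor>x\<rfloor>"] by (simp add: frac_def)

lemma expo_mult: "expo t (c * x) = expo (c * t) x"
  by (simp add: expo_def mult_ac)

section \<open>Invariance of the measure modulo 1 under dilation\<close>

lemma borel_measurable_frac [measurable]: "(frac :: real \<Rightarrow> real) \<in> borel_measurable borel"
  unfolding frac_def[abs_def] by measurable

lemma bernoulli_convolution_frac:
  assumes \<mu>: "is_bernoulli_convolution (1 / c) \<mu>" and c: "c \<noteq> 0"
  shows "distr \<mu> borel (\<lambda>x. frac (c * x)) = distr \<mu> borel frac"
proof (rule measure_eqI)
  interpret prob_space \<mu> using \<mu> by (simp add: is_bernoulli_convolution_def)
  have [measurable_cong]: "sets \<mu> = sets borel" using \<mu> by (simp add: is_bernoulli_convolution_def)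
  have sp: "space \<mu> = UNIV" using sets_eq_imp_space_eq[OF \<open>sets \<mu> = sets borel\<close>] by simp
  fix A assume "A \<in> sets (distr \<mu> borel (\<lambda>x. frac (c * x)))"
  then have [measurable]: "A \<in> sets borel" by simp
  have "(\<lambda>x. frac (c * x)) -` A \<inter> space borel \<in> sets borel" by measurable
  then have "(\<lambda>x. frac (c * x)) -` A \<in> sets borel" by simp
  moreover have "tau (1 / c) s -` ((\<lambda>x. frac (c * x)) -` A) = frac -` A" if "s = 1 \<or> s = -1" for s
  proof -
    have "frac (c * tau (1 / c) s x) = frac x" for x
      using that c frac_1_eq[of x] frac_1_eq[of "x - 1"] by (auto simp: tau_def)
    then show ?thesis by auto
  qed
  ultimately have "measure \<mu> ((\<lambda>x. frac (c * x)) -` A) = measure \<mu> (frac -` A)"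
    using \<mu> unfolding is_bernoulli_convolution_def by fastforce
  then show "emeasure (distr \<mu> borel (\<lambda>x. frac (c * x))) A = emeasure (distr \<mu> borel frac) A"
    by (simp add: emeasure_distr emeasure_eq_measure sp)
qed simp

text \<open>The hypothesis \<open>periodic\<close> makes \<open>h\<close> factor through
  \<open>frac\<close>, so both norms are integrals of \<open>h\<close> against image measures that
  coincide by \<open>bernoulli_convolution_frac\<close>.\<close>

lemma bernoulli_convolution_norm_dilation:
  assumes \<mu>: "is_bernoulli_convolution (1 / c) \<mu>" and c: "c \<noteq> 0"
    and h: "h \<in> borel_measurable borel" and periodic: "\<And>x. h (frac x) = h x"
  shows "L2_norm \<mu> (\<lambda>x. h (c * x)) = L2_norm \<mu> h"
proof -
  have [measurable_cong]: "sets \<mu> = sets borel" using \<mu> by (simp add: is_bernoulli_convolution_def)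
  note [measurable] = h
  have "(LINT x|\<mu>. (cmod (h (frac (c * x))))\<^sup>2) = (LINT y|distr \<mu> borel (\<lambda>x. frac (c * x)). (cmod (h y))\<^sup>2)"
    by (rule integral_distr[symmetric]) measurable
  also have "\<dots> = (LINT x|\<mu>. (cmod (h (frac x)))\<^sup>2)"
    unfolding bernoulli_convolution_frac[OF \<mu> c] by (rule integral_distr) measurable
  finally show ?thesis by (simp add: L2_norm_def periodic)
qed

text \<open>The key step: the action of \<open>S\<close> extends from frequencies in
  \<open>G\<close> to all integers. A combination of basis exponentials close to
  \<open>expo t\<close> has an image under \<open>S\<close> close to \<open>S (expo t)\<close>, as
  \<open>S\<close> is isometric, and close to \<open>expo (c * t)\<close>, as dilation by
  \<open>c\<close> preserves the norm of the 1-periodic error.\<close>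

lemma isometry_expo_dilation:
  assumes \<mu>: "is_bernoulli_convolution (1 / c) \<mu>" and c: "c \<noteq> 0"
    and G: "G \<subseteq> \<int>" and basis: "L2_orthonormal_basis \<mu> (expo ` G)"
    and S: "L2_isometry \<mu> S"
    and S_expo: "\<And>\<gamma>. \<gamma> \<in> G \<Longrightarrow> L2_eq \<mu> (S (expo \<gamma>)) (expo (c * \<gamma>))"
    and t: "t \<in> \<int>"
  shows "L2_eq \<mu> (S (expo t)) (expo (c * t))"
proof (rule L2_eq_if_common_approx)
  have sets: "sets \<mu> = sets borel" and "prob_space \<mu>"
    using \<mu> by (auto simp: is_bernoulli_convolution_def)
  then have expo: "expo s \<in> L2 \<mu>" for s
    by (intro expo_in_L2 prob_space.finite_measure)
  note closed = L2_linear_closed[OF L2_isometry_linear[OF S]]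
  show "S (expo t) \<in> L2 \<mu>" "expo (c * t) \<in> L2 \<mu>" by (auto intro: expo closed)
  fix \<epsilon> :: real assume "\<epsilon> > 0"
  then obtain F a where F: "finite F" "F \<subseteq> expo ` G"
    and less: "L2_norm \<mu> (\<lambda>x. expo t x - (\<Sum>b\<in>F. a b * b x)) < \<epsilon>"
    using L2_basis_approx[OF basis expo] by blast
  have FL: "F \<subseteq> L2 \<mu>" using F expo by auto
  have dil: "(\<lambda>x. b (c * x)) \<in> L2 \<mu>" "L2_eq \<mu> (S b) (\<lambda>x. b (c * x))" "\<And>x. b (frac x) = b x"
    if "b \<in> F" for b
    using that F G S_expo expo by (auto simp: expo_mult expo_frac subset_iff)
  \<comment> \<open>On basis elements \<open>S\<close> is dilation by \<open>c\<close>, and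
    \<open>expo (c * t) x\<close> is \<open>expo t (c * x)\<close>; the difference becomes the
    original error evaluated at \<open>c * x\<close>.\<close>
  have "L2_norm \<mu> (\<lambda>x. expo (c * t) x - (\<Sum>b\<in>F. a b * S b x))
      = L2_norm \<mu> (\<lambda>x. expo (c * t) x - (\<Sum>b\<in>F. a b * b (c * x)))"
    using F FL dil by (intro L2_norm_diff_sum_cong expo) (auto intro: closed)
  also have "\<dots> = L2_norm \<mu> (\<lambda>x. expo t x - (\<Sum>b\<in>F. a b * b x))"
  proof -
    have "(\<lambda>x. expo t x - (\<Sum>b\<in>F. a b * b x)) \<in> L2 \<mu>"
      using FL by (intro L2_diff expo L2_sum) auto
    then have "(\<lambda>x. expo t x - (\<Sum>b\<in>F. a b * b x)) \<in> borel_measurable borel"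
      by (simp add: L2_def measurable_cong_sets[OF sets refl])
    \<comment> \<open>Periodicity of the error: the sum is handled here through
      \<open>G \<subseteq> \<int>\<close>, the term \<open>expo t\<close> through
      \<open>t \<in> \<int>\<close>.\<close>
    moreover have "(\<Sum>b\<in>F. a b * b (frac x)) = (\<Sum>b\<in>F. a b * b x)" for x
      by (intro sum.cong refl) (simp only: dil(3))
    ultimately show ?thesis
      using bernoulli_convolution_norm_dilation[OF \<mu> c, of "\<lambda>x. expo t x - (\<Sum>b\<in>F. a b * b x)"] t
      by (simp add: expo_mult expo_frac)
  qed
  finally show "\<exists>h\<in>L2 \<mu>. L2_norm \<mu> (\<lambda>x. S (expo t) x - h x) < \<epsilon> \<and> L2_norm \<mu> (\<lambda>x. expo (c * t) x - h x) < \<epsilon>"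
    using less F FL
    by (intro bexI[of _ "\<lambda>x. \<Sum>b\<in>F. a b * S b x"])
       (auto simp: L2_isometry_norm_diff_sum[OF S expo] intro!: L2_sum closed)
qed

section \<open>Arithmetic of the frequency set \<Gamma>\<close>

text \<open>This is where evenness enters: it makes the nonzero digit \<open>n / 2\<close> an
  integer.\<close>

lemma Gamma_set_subset_Ints: "even n \<Longrightarrow> Gamma_set n \<subseteq> \<int>"
proof -
  assume "even n"
  then obtain k where "n = 2 * k" by blast
  then have "real n / 2 \<in> \<int>" by simp
  then have "a \<in> \<int>" if "a \<in> {0, real n / 2}" for a
    using that by (metis Ints_0 insertE singletonD)
  then show ?thesis
    unfolding Gamma_set_def by (fastforce intro!: Ints_sum Ints_mult Ints_power simp del: insert_iff)
qed

text \<open>Multiplication by the base \<open>2 * real n\<close> shifts the digits up one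
  place.\<close>

lemma Gamma_set_scale: "\<gamma> \<in> Gamma_set n \<Longrightarrow> 2 * real n * \<gamma> \<in> Gamma_set n"
proof -
  assume "\<gamma> \<in> Gamma_set n"
  then obtain m a where \<gamma>: "\<gamma> = (\<Sum>i\<le>m. a i * (2 * real n) ^ i)" and a: "\<forall>i\<le>m. a i \<in> {0, real n / 2}"
    unfolding Gamma_set_def by blast
  \<comment> \<open>The vacated lowest place receives the admissible digit 0.\<close>
  define b where "b i = (case i of 0 \<Rightarrow> 0 | Suc j \<Rightarrow> a j)" for i
  have "2 * real n * \<gamma> = (\<Sum>i\<le>Suc m. b i * (2 * real n) ^ i)"
    unfolding sum.atMost_Suc_shift by (simp add: b_def \<gamma> sum_distrib_left mult_ac)
  moreover have "\<forall>i\<le>Suc m. b i \<in> {0, real n / 2}"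
    using a by (auto simp: b_def split: nat.split)
  ultimately show ?thesis unfolding Gamma_set_def by blast
qed

theorem theorem4p3:
  fixes n :: nat and p :: int and \<mu> :: "real measure"
    and U S\<^sub>0 :: "(real \<Rightarrow> complex) \<Rightarrow> (real \<Rightarrow> complex)"
  assumes "n \<ge> 1" and "odd p"
    and "is_bernoulli_convolution (1 / (2 * real n)) \<mu>"
    and "L2_orthonormal_basis \<mu> (expo ` Gamma_set n)"
    and "L2_orthonormal_basis \<mu> ((\<lambda>\<gamma>. expo (of_int p * \<gamma>)) ` Gamma_set n)"
    and "L2_unitary \<mu> U"
    and "\<And>\<gamma>. \<gamma> \<in> Gamma_set n \<Longrightarrow> L2_eq \<mu> (U (expo \<gamma>)) (expo (of_int p * \<gamma>))"
    and "L2_isometry \<mu> S\<^sub>0"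
    and "\<And>\<gamma>. \<gamma> \<in> Gamma_set n \<Longrightarrow> L2_eq \<mu> (S\<^sub>0 (expo \<gamma>)) (expo (2 * real n * \<gamma>))"
    and "even n"
  shows "\<forall>f\<in>L2 \<mu>. L2_eq \<mu> (S\<^sub>0 (U f)) (U (S\<^sub>0 f))"
proof
  have U: "L2_isometry \<mu> U" using assms(6) by (simp add: L2_unitary_def)
  have expo: "expo s \<in> L2 \<mu>" for s
    using assms(3) by (auto simp: is_bernoulli_convolution_def intro!: expo_in_L2 prob_space.finite_measure)
  note linU = L2_isometry_linear[OF U] and linS = L2_isometry_linear[OF assms(8)]
  fix f assume "f \<in> L2 \<mu>"
  then show "L2_eq \<mu> (S\<^sub>0 (U f)) (U (S\<^sub>0 f))"
  \<comment> \<open>Both compositions are isometries, so it suffices to compare them on the basis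
    indexed by \<Gamma>.\<close>
  proof (rule L2_isometries_eq_on_basis[OF assms(4) L2_isometry_comp[OF assms(8) U] L2_isometry_comp[OF U assms(8)], rotated])
    fix b assume "b \<in> expo ` Gamma_set n"
    then obtain \<gamma> where \<gamma>: "\<gamma> \<in> Gamma_set n" and b: "b = expo \<gamma>" by blast
    then have "of_int p * \<gamma> \<in> \<int>" using Gamma_set_subset_Ints[OF assms(10)] by auto
    have "L2_eq \<mu> (S\<^sub>0 (U b)) (S\<^sub>0 (expo (of_int p * \<gamma>)))"
      unfolding b by (intro L2_linear_cong[OF linS] L2_linear_closed[OF linU] expo assms(7) \<gamma>)
    \<comment> \<open>The frequency \<open>of_int p * \<gamma>\<close> need not lie in \<Gamma>, so
      the defining relation of \<open>S\<^sub>0\<close> does not apply directly; being an integer,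
      it is covered by \<open>isometry_expo_dilation\<close>.\<close>
    also have "L2_eq \<mu> \<dots> (expo (2 * real n * (of_int p * \<gamma>)))"
      using isometry_expo_dilation[OF assms(3) _ Gamma_set_subset_Ints[OF assms(10)] assms(4,8,9) \<open>of_int p * \<gamma> \<in> \<int>\<close>]
        assms(1) by simp
    \<comment> \<open>Here the defining relation of \<open>U\<close> suffices, since \<Gamma> is
      closed under multiplication by \<open>2 * real n\<close>.\<close>
    also have "L2_eq \<mu> \<dots> (U (expo (2 * real n * \<gamma>)))"
      using L2_eq_sym[OF assms(7)[OF Gamma_set_scale[OF \<gamma>]]] by (simp add: mult_ac)
    also have "L2_eq \<mu> \<dots> (U (S\<^sub>0 b))"
      unfolding b by (intro L2_linear_cong[OF linU] L2_linear_closed[OF linS] expo L2_eq_sym[OF assms(9)] \<gamma>)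
    finally show "L2_eq \<mu> (S\<^sub>0 (U b)) (U (S\<^sub>0 b))" .
  qed
qed

end
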